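(* Let $A\in\mathbb{R}[\mathtt{x}]^{\alpha\times\alpha}$ be a linear pencil in the variables $\mathtt{x}=(\mathtt{x}_1,\dots,\mathtt{x}_n)$ and assume that $S_A$ is bounded. If $f\in\mathbb{R}[\mathtt{x}]$ satisfies $f(x)>0$ for all $x\in S_A$, then $f\in M_A$.
   Context: Let $\mathtt{x}=(\mathtt{x}_1,\dots,\mathtt{x}_n)$ be commuting variables and $\mathbb{R}[\mathtt{x}]$ the polynomial ring. A linear pencil of size $\alpha$ is a symmetric matrix $A\in\mathbb{R}[\mathtt{x}]^{\alpha\times\alpha}$ whose entries have degree at most $1$; its spectrahedron is $S_A:=\{x\in\mathbb{R}^n\mid A(x)\succeq0\}$ ($\succeq0$ means positive semidefinite; $S_A$ may be empty, and the empty set counts as bounded). The quadratic module associated to $A$ is $$M_A:=\Big\{s+\sum_iv_i^*Av_i\ \Big|\ s\in\sum\mathbb{R}[\mathtt{x}]^2,\ v_i\in\mathbb{R}[\mathtt{x}]^\alpha\Big\}\subseteq\mathbb{R}[\mathtt{x}]$$ (finite sums; $^*$ is transpose; $\sum\mathbb{R}[\mathtt{x}]^2$ is the set of finite sums of squares of polynomials). *)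

theory Defs
  imports "HOL-Analysis.Analysis" "HOL-Library.Poly_Mapping"
begin

text \<open>
  A monomial is a finitely supported exponent function on the finite variable type \<open>'n\<close>, and
  a real polynomial is a finitely supported family of coefficients indexed by monomials.
  The ring operations are those of \<^theory>\<open>HOL-Library.Poly_Mapping\<close>, whose product is convolution.
\<close>

type_synonym 'n rpoly = "('n \<Rightarrow>\<^sub>0 nat) \<Rightarrow>\<^sub>0 real"

definition poly_eval :: "real ^ 'n \<Rightarrow> 'n::finite rpoly \<Rightarrow> real" where
  "poly_eval x p = (\<Sum>m\<in>Poly_Mapping.keys p.
      Poly_Mapping.lookup p m * (\<Prod>i\<in>UNIV. (x $ i) ^ Poly_Mapping.lookup m i))"

text \<open>The zero polynomial gets degree 0; only upper bounds on degrees are used below.\<close>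

definition total_degree :: "'n::finite rpoly \<Rightarrow> nat" where
  "total_degree p =
     Max (insert 0 ((\<lambda>m. \<Sum>i\<in>UNIV. Poly_Mapping.lookup m i) ` Poly_Mapping.keys p))"

definition pos_semidef :: "real ^ 'a ^ 'a::finite \<Rightarrow> bool" where
  "pos_semidef B \<longleftrightarrow> transpose B = B \<and> (\<forall>v. 0 \<le> v \<bullet> (B *v v))"

definition linear_pencil :: "'n::finite rpoly ^ 'a ^ 'a::finite \<Rightarrow> bool" where
  "linear_pencil A \<longleftrightarrow> transpose A = A \<and> (\<forall>i j. total_degree (A $ i $ j) \<le> 1)"

definition spectrahedron :: "'n::finite rpoly ^ 'a ^ 'a::finite \<Rightarrow> (real ^ 'n) set" where
  "spectrahedron A = {x. pos_semidef (map_matrix (poly_eval x) A)}"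

definition sums_of_squares :: "'n::finite rpoly set" where
  "sums_of_squares = {\<Sum>i<k. (p i)\<^sup>2 | (k :: nat) p. True}"

definition quadratic_module :: "'n::finite rpoly ^ 'a ^ 'a::finite \<Rightarrow> 'n rpoly set" where
  "quadratic_module A =
     {s + (\<Sum>i<k. scalar_product (v i) (A *v v i)) | s (k :: nat) v. s \<in> sums_of_squares}"

end

theory Submission
  imports Defs
begin

text \<open>
  If the spectrahedron is nonempty and bounded, separation in the finite-dimensional space of affine
  forms shows that \<open>N \<plusminus> x\<^sub>i\<close> lies in the quadratic module for large \<open>N\<close>. The module is therefore
  archimedean, and Putinar's theorem applies.

  If the spectrahedron is empty, the claim is that \<open>-1\<close> lies in the module. Otherwise extend the
  module to a maximal proper quadratic module \<open>Q\<close>; its support is a radical ideal. Let \<open>W\<close> be the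
  space of affine forms in the support and \<open>K\<close> the space of real vectors \<open>v\<close> such that \<open>A v\<close> has all
  entries in \<open>W\<close>. Radicality implies that \<open>v\<^sup>T A v\<close> lies in \<open>W\<close> only for \<open>v \<in> K\<close>. Hence
  \<open>W\<close> misses the convex hull of \<open>1\<close> and the compact set of all \<open>v\<^sup>T A v\<close> with \<open>v\<close> a unit
  vector orthogonal to \<open>K\<close>, and a hyperplane separating the two yields a point of the
  spectrahedron.
\<close>

section \<open>Quadratic modules in commutative rings containing the reals\<close>

locale real_ring =
  fixes c :: "real \<Rightarrow> 'r::comm_ring_1"
  assumes c_add: "c (x + y) = c x + c y"
    and c_mult: "c (x * y) = c x * c y"
    and c_1 [simp]: "c 1 = 1"
begin

lemma c_0 [simp]: "c 0 = 0"
  using c_add[of 0 0] by simp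

lemma c_minus: "c (- x) = - c x"
  using c_add[of x "- x"] by (simp add: minus_unique)

lemma c_diff: "c (x - y) = c x - c y"
  using c_add[of x "- y"] by (simp add: c_minus)

lemma c_power: "c (x ^ n) = c x ^ n"
  by (induction n) (simp_all add: c_mult)

lemma c_2: "c 2 = 2"
  using c_add[of 1 1] by simp

text \<open>Polarisation turns closure under squares into closure under products; the factor 1/4
  exists because the ring contains the reals.\<close>

lemma four_times: "a * b = c (1 / 4) * ((a + b)\<^sup>2 - (a - b)\<^sup>2)"
proof -
  have "c (1 / 4) * (c 2 * c 2) = 1"
    by (simp flip: c_mult)
  then have "c (1 / 4) * (2 * 2) = 1"
    by (simp only: c_2)
  moreover have "(a + b)\<^sup>2 - (a - b)\<^sup>2 = (2 * 2) * (a * b)"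
    by (simp add: power2_eq_square algebra_simps)
  ultimately show ?thesis
    by (simp add: mult.assoc[symmetric])
qed

definition qmod :: "'r set \<Rightarrow> bool" where
  "qmod Q \<longleftrightarrow> 1 \<in> Q \<and> (\<forall>a\<in>Q. \<forall>b\<in>Q. a + b \<in> Q) \<and> (\<forall>a\<in>Q. \<forall>b. b\<^sup>2 * a \<in> Q)"

definition supp :: "'r set \<Rightarrow> 'r set" where
  "supp Q = {a. a \<in> Q \<and> - a \<in> Q}"

text \<open>Built one square at a time, so that closure properties follow by rule induction instead
  of index manipulation.\<close>

inductive_set sos :: "'r set" where
  sos_0: "0 \<in> sos"
| sos_step: "a \<in> sos \<Longrightarrow> b\<^sup>2 + a \<in> sos"

lemma sos_add: "a \<in> sos \<Longrightarrow> b \<in> sos \<Longrightarrow> a + b \<in> sos"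
  by (induction rule: sos.induct) (auto intro: sos_step simp: add.assoc)

lemma sos_sq_mult: "a \<in> sos \<Longrightarrow> b\<^sup>2 * a \<in> sos"
proof (induction rule: sos.induct)
  case (sos_step a d)
  then have "(b * d)\<^sup>2 + b\<^sup>2 * a \<in> sos" by (blast intro: sos.sos_step)
  then show ?case by (simp add: algebra_simps power_mult_distrib)
qed (simp add: sos_0)

lemma sos_1: "1 \<in> sos"
  using sos_step[OF sos_0, of 1] by simp

lemma qmodI:
  assumes "1 \<in> Q" "\<And>a b. a \<in> Q \<Longrightarrow> b \<in> Q \<Longrightarrow> a + b \<in> Q" "\<And>a b. a \<in> Q \<Longrightarrow> b\<^sup>2 * a \<in> Q"
  shows "qmod Q"
  using assms unfolding qmod_def by blast

context
  fixes Q assumes Q: "qmod Q"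
begin

lemma qmod_1: "1 \<in> Q" and qmod_add: "a \<in> Q \<Longrightarrow> b \<in> Q \<Longrightarrow> a + b \<in> Q"
  and qmod_sq_mult: "a \<in> Q \<Longrightarrow> b\<^sup>2 * a \<in> Q"
  using Q unfolding qmod_def by blast+

lemma qmod_sq: "b\<^sup>2 \<in> Q"
  using qmod_sq_mult[OF qmod_1, of b] by simp

lemma qmod_0: "0 \<in> Q"
  using qmod_sq[of 0] by simp

lemma qmod_const: "r \<ge> 0 \<Longrightarrow> c r \<in> Q"
  using qmod_sq[of "c (sqrt r)"] by (simp flip: c_power)

lemma qmod_scale: "r \<ge> 0 \<Longrightarrow> a \<in> Q \<Longrightarrow> c r * a \<in> Q"
  using qmod_sq_mult[of a "c (sqrt r)"] by (simp flip: c_power)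

lemma qmod_scaleD: "r > 0 \<Longrightarrow> c r * a \<in> Q \<Longrightarrow> a \<in> Q"
  using qmod_scale[of "1 / r" "c r * a"] by (simp flip: c_mult mult.assoc)

lemma qmod_sos_mult: "s \<in> sos \<Longrightarrow> a \<in> Q \<Longrightarrow> s * a \<in> Q"
  by (induction rule: sos.induct) (auto simp: distrib_right intro: qmod_0 qmod_add qmod_sq_mult)

lemma qmod_sos: "s \<in> sos \<Longrightarrow> s \<in> Q"
  using qmod_sos_mult[OF _ qmod_1] by simp

lemma supp_uminus: "a \<in> supp Q \<Longrightarrow> - a \<in> supp Q"
  by (simp add: supp_def)

lemma supp_0: "0 \<in> supp Q"
  by (simp add: supp_def qmod_0)

lemma supp_add: "a \<in> supp Q \<Longrightarrow> b \<in> supp Q \<Longrightarrow> a + b \<in> supp Q"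
  using qmod_add[of a b] qmod_add[of "- a" "- b"] by (simp add: supp_def)

text \<open>The support is an ideal: up to the factor 1/4, \<open>x\<close> is
  \<open>(x + 1)\<^sup>2 - (x - 1)\<^sup>2\<close>, and these squares may multiply \<open>y\<close>
  and \<open>- y\<close>, both of which lie in \<open>Q\<close>.\<close>

lemma supp_mult: assumes "a \<in> supp Q" shows "b * a \<in> supp Q"
proof -
  have *: "x * y \<in> Q" if "y \<in> supp Q" for x y
  proof -
    have "(x + 1)\<^sup>2 * y + (x - 1)\<^sup>2 * (- y) \<in> Q"
      using that by (auto simp: supp_def intro!: qmod_add qmod_sq_mult simp del: mult_minus_right)
    then have "c (1 / 4) * ((x + 1)\<^sup>2 * y + (x - 1)\<^sup>2 * (- y)) \<in> Q"
      by (intro qmod_scale) auto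
    moreover have "c (1 / 4) * ((x + 1)\<^sup>2 * y + (x - 1)\<^sup>2 * (- y)) = (c (1 / 4) * ((x + 1)\<^sup>2 - (x - 1)\<^sup>2)) * y"
      by (simp add: algebra_simps)
    ultimately show ?thesis
      using four_times[of x 1] by simp
  qed
  show ?thesis
    using *[OF assms] *[OF supp_uminus[OF assms], of b] by (simp add: supp_def)
qed

text \<open>This set is the smallest quadratic module containing \<open>Q\<close> and
  \<open>p\<close>, the one against which maximality is tested.\<close>

lemma qmod_adjoin: "qmod {q + s * p |q s. q \<in> Q \<and> s \<in> sos}"
proof (rule qmodI)
  show "1 \<in> {q + s * p |q s. q \<in> Q \<and> s \<in> sos}"
    using qmod_1 sos_0 by force
next
  fix a b assume "a \<in> {q + s * p |q s. q \<in> Q \<and> s \<in> sos}" "b \<in> {q + s * p |q s. q \<in> Q \<and> s \<in> sos}"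
  then obtain q s q' s' where "a = q + s * p" "b = q' + s' * p" "q \<in> Q" "q' \<in> Q" "s \<in> sos" "s' \<in> sos"
    by blast
  then have "a + b = (q + q') + (s + s') * p" "q + q' \<in> Q" "s + s' \<in> sos"
    by (auto simp: distrib_right add.assoc add.left_commute intro: qmod_add sos_add)
  then show "a + b \<in> {q + s * p |q s. q \<in> Q \<and> s \<in> sos}"
    by blast
next
  fix a b assume "a \<in> {q + s * p |q s. q \<in> Q \<and> s \<in> sos}"
  then obtain q s where "a = q + s * p" "q \<in> Q" "s \<in> sos"
    by blast
  then have "b\<^sup>2 * a = b\<^sup>2 * q + (b\<^sup>2 * s) * p" "b\<^sup>2 * q \<in> Q" "b\<^sup>2 * s \<in> sos"
    by (auto simp: distrib_left mult.assoc intro: qmod_sq_mult sos_sq_mult)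
  then show "b\<^sup>2 * a \<in> {q + s * p |q s. q \<in> Q \<and> s \<in> sos}"
    by blast
qed

text \<open>The weights (r + p)^2 and (r - p)^2 combine the two bounds into 2r(r^2 - p^2), from
  which the positive constant 2r can be cancelled.\<close>

lemma qmod_sq_le:
  assumes "r > 0" "c r - p \<in> Q" "c r + p \<in> Q"
  shows "c (r\<^sup>2) - p\<^sup>2 \<in> Q"
proof -
  have "(c r + p)\<^sup>2 * (c r - p) + (c r - p)\<^sup>2 * (c r + p) \<in> Q"
    by (rule qmod_add[OF qmod_sq_mult[OF assms(2)] qmod_sq_mult[OF assms(3)]])
  also have "(c r + p)\<^sup>2 * (c r - p) + (c r - p)\<^sup>2 * (c r + p) = c (2 * r) * (c (r\<^sup>2) - p\<^sup>2)"
    by (simp add: c_mult c_power c_2 power2_eq_square algebra_simps)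
  finally show ?thesis
    using assms(1) by (auto intro: qmod_scaleD[of "2 * r"])
qed

lemma c_mem_iff: assumes "-1 \<notin> Q" shows "c r \<in> Q \<longleftrightarrow> r \<ge> 0"
proof
  assume "c r \<in> Q"
  show "r \<ge> 0"
  proof (rule ccontr)
    assume "\<not> r \<ge> 0"
    then have "c (1 / - r) * c r \<in> Q"
      using \<open>c r \<in> Q\<close> by (intro qmod_scale) auto
    also have "c (1 / - r) * c r = - 1"
      using \<open>\<not> r \<ge> 0\<close> by (simp flip: c_mult add: c_minus)
    finally show False using assms by blast
  qed
qed (rule qmod_const)

end

section \<open>Maximal proper quadratic modules\<close>

definition maximal_qmod :: "'r set \<Rightarrow> bool" where
  "maximal_qmod Q \<longleftrightarrow> qmod Q \<and> -1 \<notin> Q \<and> (\<forall>Q'. qmod Q' \<and> -1 \<notin> Q' \<and> Q \<subseteq> Q' \<longrightarrow> Q' = Q)"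

text \<open>Zorn's lemma applies because any two elements of the union of a chain lie in a common
  member, so the union is again a proper quadratic module.\<close>

lemma maximal_qmod_exists:
  assumes M: "qmod M" "-1 \<notin> M"
  obtains Q where "maximal_qmod Q" "M \<subseteq> Q"
proof -
  let ?F = "{Q. qmod Q \<and> -1 \<notin> Q \<and> M \<subseteq> Q}"
  have "\<exists>Q\<in>?F. \<forall>X\<in>?F. Q \<subseteq> X \<longrightarrow> X = Q"
  proof (rule subset_Zorn_nonempty)
    show "?F \<noteq> {}" using M by blast
  next
    fix K assume K: "K \<noteq> {}" "subset.chain ?F K"
    then have KF: "\<And>X. X \<in> K \<Longrightarrow> qmod X \<and> -1 \<notin> X \<and> M \<subseteq> X"
      and lin: "\<And>X Y. X \<in> K \<Longrightarrow> Y \<in> K \<Longrightarrow> X \<subseteq> Y \<or> Y \<subseteq> X"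
      by (auto simp: subset_chain_def)
    have "qmod (\<Union>K)"
    proof (rule qmodI)
      show "1 \<in> \<Union>K" using K(1) KF qmod_1 by blast
    next
      fix a b assume "a \<in> \<Union>K" "b \<in> \<Union>K"
      then obtain X where "X \<in> K" "a \<in> X" "b \<in> X" using lin by blast
      then show "a + b \<in> \<Union>K" using KF qmod_add by blast
    next
      fix a b assume "a \<in> \<Union>K"
      then show "b\<^sup>2 * a \<in> \<Union>K" using KF qmod_sq_mult by blast
    qed
    then show "\<Union>K \<in> ?F" using K(1) KF by blast
  qed
  then obtain Q where Q: "Q \<in> ?F" "\<forall>X\<in>?F. Q \<subseteq> X \<longrightarrow> X = Q" ..
  have "maximal_qmod Q"
    unfolding maximal_qmod_def
  proof (intro conjI allI impI)
    fix X assume "qmod X \<and> -1 \<notin> X \<and> Q \<subseteq> X"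
    moreover have "M \<subseteq> X" using Q(1) calculation by blast
    ultimately show "X = Q" using Q(2) by simp
  qed (use Q in simp_all)
  then show ?thesis using that Q(1) by simp
qed

context
  fixes Q assumes Qmax: "maximal_qmod Q"
begin

lemma maximal_qmod_qmod: "qmod Q" and maximal_qmod_proper: "-1 \<notin> Q"
  using Qmax by (auto simp: maximal_qmod_def)

lemma maximal_qmod_extend:
  assumes "p \<notin> Q"
  obtains q s where "q \<in> Q" "s \<in> sos" "-1 = q + s * p"
proof -
  let ?Q' = "{q + s * p |q s. q \<in> Q \<and> s \<in> sos}"
  have "Q \<subseteq> ?Q'" using sos_0 by force
  moreover have "p \<in> ?Q'" using qmod_0[OF maximal_qmod_qmod] sos_1 by force
  ultimately have "-1 \<in> ?Q'"
    using Qmax assms qmod_adjoin[OF maximal_qmod_qmod, of p] unfolding maximal_qmod_def by blast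
  then show ?thesis using that by blast
qed

text \<open>If both signs failed, adjoining either would produce -1. Eliminating \<open>p\<close>
  from the two identities puts the multiplier \<open>s1\<close> into the support; then
  \<open>s1 * p\<close> lies there too, and -1 = \<open>q1 + s1 * p\<close> falls into
  \<open>Q\<close>.\<close>

lemma maximal_qmod_total: "p \<in> Q \<or> - p \<in> Q"
proof (rule ccontr)
  note Q = maximal_qmod_qmod
  assume "\<not> ?thesis"
  then obtain q1 s1 q2 s2 where 1: "q1 \<in> Q" "s1 \<in> sos" "-1 = q1 + s1 * p"
    and 2: "q2 \<in> Q" "s2 \<in> sos" "-1 = q2 + s2 * (- p)"
    by (metis maximal_qmod_extend)
  have "s1 * p = - 1 - q1" "s2 * p = 1 + q2"
    unfolding 1(3) using 2(3) by (simp_all add: eq_diff_eq minus_equation_iff diff_eq_eq add.commute)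
  \<comment> \<open>Both sides equal \<open>s1 * s2 * p\<close>.\<close>
  then have "s2 * (- 1 - q1) = s1 * (1 + q2)"
    using mult.left_commute[of s2 s1 p] by simp
  moreover have "- s1 = s1 * q2 - s1 * (1 + q2)"
    by (simp add: algebra_simps)
  ultimately have "- s1 = s1 * q2 - s2 * (- 1 - q1)"
    by simp
  then have "- s1 = s2 + s2 * q1 + s1 * q2"
    by (simp add: algebra_simps)
  also have "\<dots> \<in> Q"
    by (rule qmod_add[OF Q qmod_add[OF Q qmod_sos[OF Q 2(2)]
          qmod_sos_mult[OF Q 2(2) 1(1)]] qmod_sos_mult[OF Q 1(2) 2(1)]])
  finally have "s1 \<in> supp Q"
    using 1 qmod_sos[OF Q] by (simp add: supp_def)
  then have "p * s1 \<in> Q" using supp_mult[OF Q] by (simp add: supp_def)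
  then have "-1 \<in> Q" using 1 qmod_add[OF Q] by (simp add: mult.commute)
  then show False using maximal_qmod_proper by blast
qed

text \<open>If \<open>p\<close> were outside \<open>Q\<close>, then \<open>s * p = - (1 + q)\<close>
  with \<open>q\<close> in \<open>Q\<close> and \<open>s\<close> a sum of squares. Squaring gives -1
  = 2q + q^2 - s^2 p^2, and the last term lies in \<open>Q\<close> when p^2 is in the support. The
  same argument applies to \<open>- p\<close>.\<close>

lemma maximal_qmod_supp_radical:
  assumes "p\<^sup>2 \<in> supp Q"
  shows "p \<in> supp Q"
proof -
  note Q = maximal_qmod_qmod
  have "p \<in> Q" if "p\<^sup>2 \<in> supp Q" for p
  proof (rule ccontr)
    assume "p \<notin> Q"
    then obtain q s where 1: "q \<in> Q" "s \<in> sos" "-1 = q + s * p"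
      by (metis maximal_qmod_extend)
    have "- (s\<^sup>2 * p\<^sup>2) \<in> Q"
      using supp_mult[OF Q that, of "s\<^sup>2"] by (simp add: supp_def)
    then have "q + q + q\<^sup>2 + - (s\<^sup>2 * p\<^sup>2) \<in> Q"
      using 1 Q by (intro qmod_add qmod_sq) auto
    also have "q + q + q\<^sup>2 + - (s\<^sup>2 * p\<^sup>2) = -1"
    proof -
      have "s * p = - (1 + q)" using 1(3) by (simp add: algebra_simps)
      then have "s\<^sup>2 * p\<^sup>2 = (1 + q)\<^sup>2" by (simp only: power_mult_distrib[symmetric] power2_minus)
      then show ?thesis by (simp add: power2_eq_square algebra_simps)
    qed
    finally show False using maximal_qmod_proper by blast
  qed
  from this[of p] this[of "- p"] show ?thesis using assms by (simp add: supp_def)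
qed

end

section \<open>Archimedean quadratic modules\<close>

definition archimedean_qmod :: "'r set \<Rightarrow> bool" where
  "archimedean_qmod Q \<longleftrightarrow> qmod Q \<and> (\<forall>p. \<exists>r. c r - p \<in> Q)"

text \<open>For a quadratic module these elements form a subring containing the constants, so the
  archimedean property can be checked on generators.\<close>

definition bounded_elems :: "'r set \<Rightarrow> 'r set" where
  "bounded_elems Q = {p. \<exists>r. c r - p \<in> Q \<and> c r + p \<in> Q}"

definition real_hom :: "('r \<Rightarrow> real) \<Rightarrow> bool" where
  "real_hom \<phi> \<longleftrightarrow> (\<forall>p q. \<phi> (p + q) = \<phi> p + \<phi> q) \<and> (\<forall>p q. \<phi> (p * q) = \<phi> p * \<phi> q)
     \<and> (\<forall>r. \<phi> (c r) = r)"

context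
  fixes Q assumes Q: "qmod Q"
begin

lemma bounded_elems_uminus: "p \<in> bounded_elems Q \<Longrightarrow> - p \<in> bounded_elems Q"
  by (auto simp: bounded_elems_def)

lemma bounded_elems_add:
  assumes "p \<in> bounded_elems Q" "q \<in> bounded_elems Q"
  shows "p + q \<in> bounded_elems Q"
proof -
  obtain r t where "c r - p \<in> Q" "c r + p \<in> Q" "c t - q \<in> Q" "c t + q \<in> Q"
    using assms by (auto simp: bounded_elems_def)
  then have "(c r - p) + (c t - q) \<in> Q" "(c r + p) + (c t + q) \<in> Q"
    using Q by (blast intro: qmod_add)+
  then have "c (r + t) - (p + q) \<in> Q" "c (r + t) + (p + q) \<in> Q"
    by (simp_all add: c_add algebra_simps)
  then show ?thesis by (auto simp: bounded_elems_def)
qed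

lemma bounded_elems_const: "c r \<in> bounded_elems Q"
proof -
  have "c \<bar>r\<bar> - c r \<in> Q" "c \<bar>r\<bar> + c r \<in> Q"
    by (auto simp flip: c_add c_diff intro!: qmod_const Q)
  then show ?thesis by (auto simp: bounded_elems_def)
qed

lemma bounded_elems_pos:
  assumes "p \<in> bounded_elems Q"
  obtains r where "r > 0" "c r - p \<in> Q" "c r + p \<in> Q"
proof -
  obtain r where r: "c r - p \<in> Q" "c r + p \<in> Q"
    using assms by (auto simp: bounded_elems_def)
  have "(c r - p) + c (\<bar>r\<bar> + 1 - r) \<in> Q" "(c r + p) + c (\<bar>r\<bar> + 1 - r) \<in> Q"
    using r Q by (auto intro!: qmod_add qmod_const)
  then show ?thesis using that[of "\<bar>r\<bar> + 1"] by (simp add: c_add c_diff algebra_simps)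
qed

lemma bounded_elems_sq:
  assumes "p \<in> bounded_elems Q"
  shows "p\<^sup>2 \<in> bounded_elems Q"
proof -
  obtain r where "r > 0" "c r - p \<in> Q" "c r + p \<in> Q"
    using bounded_elems_pos[OF assms] by blast
  then have "c (r\<^sup>2) - p\<^sup>2 \<in> Q" using qmod_sq_le[OF Q] by blast
  moreover have "c (r\<^sup>2) + p\<^sup>2 \<in> Q" using Q by (auto intro!: qmod_add qmod_const qmod_sq)
  ultimately show ?thesis by (auto simp: bounded_elems_def)
qed

lemma bounded_elems_scale:
  assumes "p \<in> bounded_elems Q" "t \<ge> 0"
  shows "c t * p \<in> bounded_elems Q"
proof -
  obtain r where "c r - p \<in> Q" "c r + p \<in> Q"
    using assms by (auto simp: bounded_elems_def)
  then have "c t * (c r - p) \<in> Q" "c t * (c r + p) \<in> Q"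
    using Q assms(2) by (blast intro: qmod_scale)+
  then have "c (t * r) - c t * p \<in> Q" "c (t * r) + c t * p \<in> Q"
    by (simp_all add: c_mult algebra_simps)
  then show ?thesis by (auto simp: bounded_elems_def)
qed

lemma bounded_elems_mult:
  assumes "p \<in> bounded_elems Q" "q \<in> bounded_elems Q"
  shows "p * q \<in> bounded_elems Q"
proof -
  have "(p + q)\<^sup>2 + - (p + - q)\<^sup>2 \<in> bounded_elems Q"
    using assms by (intro bounded_elems_add bounded_elems_uminus bounded_elems_sq)
  then have "c (1 / 4) * ((p + q)\<^sup>2 - (p - q)\<^sup>2) \<in> bounded_elems Q"
    using bounded_elems_scale by simp
  then show ?thesis using four_times by simp
qed

lemma bounded_elems_power: "p \<in> bounded_elems Q \<Longrightarrow> p ^ n \<in> bounded_elems Q"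
  by (induction n) (use bounded_elems_const[of 1] bounded_elems_mult in auto)

lemma bounded_elems_sum: "(\<And>i. i \<in> I \<Longrightarrow> f i \<in> bounded_elems Q) \<Longrightarrow> (\<Sum>i\<in>I. f i) \<in> bounded_elems Q"
  by (induction I rule: infinite_finite_induct) (use bounded_elems_const[of 0] bounded_elems_add in auto)

lemma bounded_elems_prod: "(\<And>i. i \<in> I \<Longrightarrow> f i \<in> bounded_elems Q) \<Longrightarrow> (\<Prod>i\<in>I. f i) \<in> bounded_elems Q"
  by (induction I rule: infinite_finite_induct) (use bounded_elems_const[of 1] bounded_elems_mult in auto)

lemma archimedean_qmodI: "bounded_elems Q = UNIV \<Longrightarrow> archimedean_qmod Q"
  using Q unfolding archimedean_qmod_def bounded_elems_def by blast

end

section \<open>Infinitesimals and homomorphisms to the reals\<close>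

definition infinitesimals :: "'r set \<Rightarrow> 'r set" where
  "infinitesimals Q = {p. \<forall>e>0. c e - p \<in> Q \<and> c e + p \<in> Q}"

lemma infinitesimals_add:
  assumes "qmod Q" "p \<in> infinitesimals Q" "q \<in> infinitesimals Q"
  shows "p + q \<in> infinitesimals Q"
proof -
  have "c e - (p + q) \<in> Q \<and> c e + (p + q) \<in> Q" if "e > 0" for e
  proof -
    have "(c (e / 2) - p) + (c (e / 2) - q) \<in> Q" "(c (e / 2) + p) + (c (e / 2) + q) \<in> Q"
      by (rule qmod_add[OF assms(1)]; use assms(2,3) that in \<open>simp add: infinitesimals_def\<close>)+
    moreover have "c e = c (e / 2) + c (e / 2)" by (simp flip: c_add)
    ultimately show ?thesis by (simp add: algebra_simps)
  qed
  then show ?thesis by (simp add: infinitesimals_def)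
qed

text \<open>Completing the square: (p + tq)^2 produces the cross term 2tqp, while p^2 and q^2 are
  absorbed by the bounds d^2 - p^2 and K - q^2 in \<open>Q\<close>.\<close>

lemma infinitesimals_mult:
  assumes Q: "archimedean_qmod Q" and p: "p \<in> infinitesimals Q"
  shows "q * p \<in> infinitesimals Q"
proof -
  have Qq: "qmod Q" using Q by (simp add: archimedean_qmod_def)
  have *: "c e + q * p \<in> Q" if "e > 0" for q e
  proof -
    obtain K0 where K0: "c K0 - q\<^sup>2 \<in> Q" using Q by (auto simp: archimedean_qmod_def)
    define K where "K = \<bar>K0\<bar> + 1"
    have "(c K0 - q\<^sup>2) + c (\<bar>K0\<bar> + 1 - K0) \<in> Q"
      using K0 Qq by (auto intro!: qmod_add qmod_const)
    then have K: "c K - q\<^sup>2 \<in> Q" "K > 0" by (simp_all add: K_def c_add c_diff algebra_simps)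
    \<comment> \<open>With these values d^2 = t^2 K = te, so the constant d^2 + t^2 K is 2te and the
      factor 2t can be cancelled.\<close>
    define t where "t = e / K"
    define d where "d = t * sqrt K"
    have pos: "t > 0" "d > 0" using \<open>K > 0\<close> \<open>e > 0\<close> by (simp_all add: t_def d_def)
    have "c (d\<^sup>2) - p\<^sup>2 \<in> Q"
      using p pos qmod_sq_le[OF Qq] by (auto simp: infinitesimals_def)
    then have "(p + c t * q)\<^sup>2 + (c (d\<^sup>2) - p\<^sup>2) + c (t\<^sup>2) * (c K - q\<^sup>2) \<in> Q"
      using K Qq by (intro qmod_add qmod_sq qmod_scale) auto
    also have "(p + c t * q)\<^sup>2 + (c (d\<^sup>2) - p\<^sup>2) + c (t\<^sup>2) * (c K - q\<^sup>2) = c (2 * t) * (q * p) + c (d\<^sup>2 + t\<^sup>2 * K)"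
      by (simp add: c_mult c_add c_power c_2 power2_eq_square algebra_simps)
    also have "d\<^sup>2 + t\<^sup>2 * K = 2 * t * e"
      using K by (simp add: d_def t_def power_mult_distrib field_simps power2_eq_square)
    also have "c (2 * t) * (q * p) + c (2 * t * e) = c (2 * t) * (c e + q * p)"
      by (simp add: c_mult algebra_simps)
    finally show ?thesis using pos by (auto intro: qmod_scaleD[OF Qq, of "2 * t"])
  qed
  show ?thesis using *[of _ q] *[of _ "- q"] by (simp add: infinitesimals_def)
qed

lemma infinitesimal_const:
  assumes "qmod Q" "-1 \<notin> Q" "c r \<in> infinitesimals Q"
  shows "r = 0"
proof -
  have "c (e - r) \<in> Q \<and> c (e + r) \<in> Q" if "e > 0" for e
    using assms(3) that by (simp add: infinitesimals_def c_add c_diff)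
  then have "\<bar>r\<bar> \<le> e" if "e > 0" for e
    using that unfolding c_mem_iff[OF assms(1,2)] by fastforce
  then have "\<bar>r\<bar> \<le> 0" by (rule dense_ge)
  then show ?thesis by simp
qed

text \<open>The real part is the supremum of all \<open>r\<close> with \<open>p - c r\<close> in
  \<open>Q\<close>, finite because \<open>Q\<close> is archimedean and proper. Just above the
  supremum, totality puts the negated difference into \<open>Q\<close>; just below it, a member of
  the set supplies the other bound.\<close>

lemma real_part_exists:
  assumes Q: "archimedean_qmod Q" "maximal_qmod Q"
  shows "\<exists>r. p - c r \<in> infinitesimals Q"
proof -
  have Qq: "qmod Q" "-1 \<notin> Q" using Q by (auto simp: maximal_qmod_def)
  obtain r0 where r0: "c r0 - p \<in> Q" using Q by (auto simp: archimedean_qmod_def)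
  obtain r1 where r1: "c r1 - (- p) \<in> Q" using Q by (metis archimedean_qmod_def)
  define R where "R = {r. p - c r \<in> Q}"
  have ne: "- r1 \<in> R" using r1 by (simp add: R_def c_minus add.commute)
  have "r \<le> r0" if "r \<in> R" for r
  proof -
    have "(c r0 - p) + (p - c r) \<in> Q"
      by (rule qmod_add) (use r0 that Qq in \<open>simp_all add: R_def\<close>)
    then have "c (r0 - r) \<in> Q" by (simp add: c_diff)
    then show ?thesis using c_mem_iff[OF Qq] by simp
  qed
  then have bdd: "bdd_above R" by (auto simp: bdd_above_def)
  have "c e - (p - c (Sup R)) \<in> Q \<and> c e + (p - c (Sup R)) \<in> Q" if "e > 0" for e
  proof
    have "Sup R + e \<notin> R" using cSup_upper[OF _ bdd, of "Sup R + e"] that by auto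
    then have "- (p - c (Sup R + e)) \<in> Q"
      using maximal_qmod_total[OF Q(2)] unfolding R_def by blast
    then show "c e - (p - c (Sup R)) \<in> Q" by (simp add: c_add algebra_simps)
  next
    have "\<exists>r\<in>R. Sup R - e < r"
      by (rule less_cSupD) (use ne that in auto)
    then obtain r where r: "r \<in> R" "r > Sup R - e" by blast
    then have "(p - c r) + c (r - Sup R + e) \<in> Q"
      using Qq by (intro qmod_add qmod_const) (auto simp: R_def)
    then show "c e + (p - c (Sup R)) \<in> Q" by (simp add: c_add c_diff algebra_simps)
  qed
  then show ?thesis unfolding infinitesimals_def by blast
qed

text \<open>The homomorphism takes real parts. It respects sums and products because the
  infinitesimals form an ideal, and it is well defined because 0 is the only infinitesimal
  constant.\<close>

lemma maximal_archimedean_real_hom: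
  assumes Q: "archimedean_qmod Q" "maximal_qmod Q"
  obtains \<phi> where "real_hom \<phi>" "\<And>p. p \<in> Q \<Longrightarrow> \<phi> p \<ge> 0"
proof -
  have Qq: "qmod Q" "-1 \<notin> Q" using Q by (auto simp: maximal_qmod_def)
  let ?J = "infinitesimals Q"
  obtain \<phi> where \<phi>: "\<And>p. p - c (\<phi> p) \<in> ?J"
    using real_part_exists[OF Q] by metis
  have unique: "\<phi> p = r" if "p - c r \<in> ?J" for p r
  proof -
    have "(p - c r) + (-1) * (p - c (\<phi> p)) \<in> ?J"
      using that \<phi> by (intro infinitesimals_add infinitesimals_mult Qq Q)
    then have "c (\<phi> p - r) \<in> ?J" by (simp add: c_diff)
    then show ?thesis using infinitesimal_const[OF Qq] by fastforce
  qed
  have "\<phi> (p + q) = \<phi> p + \<phi> q" for p q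
  proof (rule unique)
    have "(p - c (\<phi> p)) + (q - c (\<phi> q)) \<in> ?J"
      using \<phi> by (intro infinitesimals_add Qq)
    then show "p + q - c (\<phi> p + \<phi> q) \<in> ?J" by (simp add: c_add algebra_simps)
  qed
  moreover have "\<phi> (p * q) = \<phi> p * \<phi> q" for p q
  proof (rule unique)
    have "q * (p - c (\<phi> p)) + c (\<phi> p) * (q - c (\<phi> q)) \<in> ?J"
      using \<phi> by (intro infinitesimals_add infinitesimals_mult Q Qq)
    then show "p * q - c (\<phi> p * \<phi> q) \<in> ?J" by (simp add: c_mult algebra_simps)
  qed
  moreover have "\<phi> (c r) = r" for r
    by (rule unique) (auto simp: infinitesimals_def intro: qmod_const Qq)
  moreover have "\<phi> p \<ge> 0" if "p \<in> Q" for p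
  proof (rule field_le_epsilon)
    fix e :: real assume "e > 0"
    then have "c e - (p - c (\<phi> p)) \<in> Q" using \<phi>[of p] by (simp add: infinitesimals_def)
    then have "(c e - (p - c (\<phi> p))) + p \<in> Q" using that Qq by (blast intro: qmod_add)
    then have "c (\<phi> p + e) \<in> Q" by (simp add: c_add algebra_simps)
    then show "0 \<le> \<phi> p + e" using c_mem_iff[OF Qq] by blast
  qed
  ultimately show ?thesis using that[of \<phi>] by (simp add: real_hom_def)
qed

section \<open>Putinar's theorem\<close>

text \<open>Adjoin \<open>- f\<close> to \<open>M\<close>. If the result were proper, a maximal
  quadratic module above it would give a homomorphism nonnegative on \<open>M\<close> and on
  \<open>- f\<close>, against positivity; so -1 = q - sf.\<close>

lemma putinar_denominator:
  assumes M: "archimedean_qmod M"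
    and pos: "\<And>\<phi>. real_hom \<phi> \<Longrightarrow> (\<And>p. p \<in> M \<Longrightarrow> \<phi> p \<ge> 0) \<Longrightarrow> \<phi> f > 0"
  obtains s where "s \<in> sos" "s * f - 1 \<in> M"
proof -
  have Mq: "qmod M" using M by (simp add: archimedean_qmod_def)
  let ?M' = "{q + s * (- f) |q s. q \<in> M \<and> s \<in> sos}"
  have "-1 \<in> ?M'"
  proof (rule ccontr)
    assume "-1 \<notin> ?M'"
    then obtain Q where Q: "maximal_qmod Q" "?M' \<subseteq> Q"
      using maximal_qmod_exists[OF qmod_adjoin[OF Mq]] by blast
    have MQ: "M \<subseteq> Q" using Q(2) sos_0 by force
    have fQ: "- f \<in> Q" using Q(2) qmod_0[OF Mq] sos_1 by force
    have "archimedean_qmod Q"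
      using M Q(1) MQ unfolding archimedean_qmod_def maximal_qmod_def by blast
    then obtain \<phi> where \<phi>: "real_hom \<phi>" "\<And>p. p \<in> Q \<Longrightarrow> \<phi> p \<ge> 0"
      using maximal_archimedean_real_hom Q(1) by blast
    have "\<phi> f > 0" using pos[of \<phi>] \<phi> MQ by blast
    moreover have "\<phi> (f + - f) = \<phi> f + \<phi> (- f)" "\<phi> (c 0) = 0"
      using \<phi>(1) unfolding real_hom_def by blast+
    ultimately show False using \<phi>(2)[OF fQ] by simp
  qed
  then obtain q s where "q \<in> M" "s \<in> sos" "-1 = q + s * (- f)" by blast
  moreover from this have "s * f - 1 = q" by (simp add: algebra_simps)
  ultimately show ?thesis using that by blast
qed

text \<open>The multiplier \<open>s\<close> is removed by a descent that starts from a constant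
  \<open>r0\<close> with \<open>f + c r0\<close> in \<open>M\<close>.\<close>

theorem putinar:
  assumes M: "archimedean_qmod M"
    and pos: "\<And>\<phi>. real_hom \<phi> \<Longrightarrow> (\<And>p. p \<in> M \<Longrightarrow> \<phi> p \<ge> 0) \<Longrightarrow> \<phi> f > 0"
  shows "f \<in> M"
proof -
  have Mq: "qmod M" and arch: "\<And>p. \<exists>r. c r - p \<in> M" using M by (auto simp: archimedean_qmod_def)
  obtain s where s: "s \<in> sos" "s * f - 1 \<in> M"
    using putinar_denominator[of M f] M pos by blast
  have sup: "c r' - p \<in> M" if "c r - p \<in> M" "r \<le> r'" for r r' p
  proof -
    have "(c r - p) + c (r' - r) \<in> M" using that Mq by (auto intro!: qmod_add qmod_const)
    then show ?thesis by (simp add: c_diff)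
  qed
  \<comment> \<open>One \<open>k\<close> serves both bounds. The 1 in \<open>2 * k - 1\<close>
    becomes the gain of the descent step, and dividing it by \<open>k\<^sup>2\<close> gives the step
    width \<open>d\<close>.\<close>
  obtain k where k: "k > 0" "c (2 * k - 1) - s\<^sup>2 * f \<in> M" "c (2 * k) - s \<in> M"
  proof -
    obtain r1 r2 where r: "c r1 - s\<^sup>2 * f \<in> M" "c r2 - s \<in> M" using arch by blast
    show ?thesis
      by (rule that[of "\<bar>r1\<bar> + \<bar>r2\<bar> + 1"]) (auto intro: sup[OF r(1)] sup[OF r(2)])
  qed
  define d where "d = 1 / k\<^sup>2"
  have "d > 0" using k by (simp add: d_def)
  \<comment> \<open>If \<open>s f \<in> 1 + M\<close>, a constant \<open>r\<close> with \<open>f + r \<in> M\<close> can be lowered by the fixed amount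
    \<open>1 / k\<^sup>2\<close> as long as \<open>r \<ge> 0\<close>.\<close>
  have step: "f + c (r - d) \<in> M" if r: "r \<ge> 0" "f + c r \<in> M" for r
  proof -
    have "s * (c (2 * k) - s) \<in> M" using s k qmod_sos_mult[OF Mq] by blast
    \<comment> \<open>The summands are weighted so that every term containing \<open>s\<close>
      cancels; the third one requires \<open>r \<ge> 0\<close>.\<close>
    then have "(s - c k)\<^sup>2 * (f + c r) + c (2 * k) * (s * f - 1) + c r * (s * (c (2 * k) - s))
        + (c (2 * k - 1) - s\<^sup>2 * f) \<in> M"
      using r k(1) s(2) by (intro qmod_add[OF Mq _ k(2)] qmod_add[OF Mq] qmod_sq_mult[OF Mq r(2)]
          qmod_scale[OF Mq]) auto
    also have "(s - c k)\<^sup>2 * (f + c r) + c (2 * k) * (s * f - 1) + c r * (s * (c (2 * k) - s))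
        + (c (2 * k - 1) - s\<^sup>2 * f) = c (k\<^sup>2) * (f + c r) - 1"
      by (simp add: c_mult c_diff c_2 c_power power2_eq_square algebra_simps)
    also have "1 = c (k\<^sup>2) * c d" using k by (simp add: d_def flip: c_mult)
    also have "c (k\<^sup>2) * (f + c r) - c (k\<^sup>2) * c d = c (k\<^sup>2) * (f + c (r - d))"
      by (simp add: c_diff algebra_simps)
    finally show ?thesis using k qmod_scaleD[OF Mq, of "k\<^sup>2"] by simp
  qed
  obtain r0 where r0: "c r0 - (- f) \<in> M" using arch by blast
  \<comment> \<open>The maximum with 0 keeps each constant in the range where \<open>step\<close>
    applies.\<close>
  have descent: "f + c (max 0 (r0 - real n * d)) \<in> M" for n
  proof (induction n)
    case 0
    show ?case using sup[OF r0, of "max 0 r0"] by (simp add: add.commute)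
  next
    case (Suc n)
    from step[OF _ Suc] have "c (max 0 (r0 - real n * d) - d) - (- f) \<in> M" by (simp add: add.commute)
    then have "c (max 0 (r0 - real (Suc n) * d)) - (- f) \<in> M"
      by (rule sup) (use \<open>d > 0\<close> in \<open>auto simp: algebra_simps max_def\<close>)
    then show ?case by (simp add: add.commute)
  qed
  obtain n where "real n * d > r0" using \<open>d > 0\<close> reals_Archimedean3 by blast
  then have "max 0 (r0 - real n * d) = 0" by simp
  then show ?thesis using descent[of n] by simp
qed

end

section \<open>Real polynomials and linear pencils\<close>

definition rpoly_const :: "real \<Rightarrow> 'n::finite rpoly" where
  "rpoly_const = Poly_Mapping.single 0"

definition rpoly_var :: "'n::finite \<Rightarrow> 'n rpoly" where
  "rpoly_var i = Poly_Mapping.single (Poly_Mapping.single i 1) 1"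

interpretation rpoly: real_ring "rpoly_const :: real \<Rightarrow> 'n::finite rpoly"
  by unfold_locales (simp_all add: rpoly_const_def single_add mult_single)

lemma rpoly_var_power: "rpoly_var i ^ k = Poly_Mapping.single (Poly_Mapping.single i k) 1"
  by (induction k) (simp_all add: rpoly_var_def mult_single flip: single_add)

lemma prod_single_one:
  fixes f :: "'i \<Rightarrow> 'a::comm_monoid_add"
  shows "(\<Prod>i\<in>I. Poly_Mapping.single (f i) (1::'b::comm_semiring_1)) = Poly_Mapping.single (\<Sum>i\<in>I. f i) 1"
  by (induction I rule: infinite_finite_induct) (simp_all add: mult_single)

lemma poly_mapping_sum_single:
  fixes m :: "'n::finite \<Rightarrow>\<^sub>0 'b::comm_monoid_add"
  shows "(\<Sum>i\<in>UNIV. Poly_Mapping.single i (Poly_Mapping.lookup m i)) = m"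
  by (rule poly_mapping_eqI) (simp add: lookup_sum lookup_single when_def)

text \<open>Reduces claims about all polynomials to constants, variables, sums and products; used
  for homomorphisms and for bounded elements.\<close>

lemma rpoly_expand:
  fixes p :: "'n::finite rpoly"
  shows "p = (\<Sum>m\<in>Poly_Mapping.keys p. rpoly_const (Poly_Mapping.lookup p m) *
               (\<Prod>i\<in>UNIV. rpoly_var i ^ Poly_Mapping.lookup m i))"
proof -
  have "rpoly_const a * (\<Prod>i\<in>UNIV. rpoly_var i ^ Poly_Mapping.lookup m i) = Poly_Mapping.single m a"
    for a and m :: "'n \<Rightarrow>\<^sub>0 nat"
    by (simp add: rpoly_var_power prod_single_one poly_mapping_sum_single rpoly_const_def mult_single)
  moreover have "p = (\<Sum>m\<in>Poly_Mapping.keys p. Poly_Mapping.single m (Poly_Mapping.lookup p m))"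
    by (rule poly_mapping_eqI) (simp add: lookup_sum lookup_single when_def in_keys_iff)
  ultimately show ?thesis by simp
qed

text \<open>A homomorphism fixing the constants is determined by its values on the variables, and
  these are the coordinates of the point.\<close>

lemma rpoly_real_hom_eq_poly_eval:
  assumes "rpoly.real_hom \<phi>"
  shows "\<phi> p = poly_eval (\<chi> i. \<phi> (rpoly_var i)) p"
proof -
  have add: "\<phi> (p + q) = \<phi> p + \<phi> q" and mult: "\<phi> (p * q) = \<phi> p * \<phi> q"
    and const: "\<phi> (rpoly_const r) = r" for p q r
    using assms by (auto simp: rpoly.real_hom_def)
  have 0: "\<phi> 0 = 0" and 1: "\<phi> 1 = 1"
    using const[of 0] const[of 1] by simp_all
  have sum: "\<phi> (\<Sum>i\<in>I. g i) = (\<Sum>i\<in>I. \<phi> (g i))" for g and I :: "('a \<Rightarrow>\<^sub>0 nat) set"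
    by (induction I rule: infinite_finite_induct) (simp_all add: add 0)
  have prod: "\<phi> (\<Prod>i\<in>I. g i) = (\<Prod>i\<in>I. \<phi> (g i))" for g and I :: "'a set"
    by (induction I rule: infinite_finite_induct) (simp_all add: mult 1)
  have power: "\<phi> (q ^ k) = \<phi> q ^ k" for q k
    by (induction k) (simp_all add: mult 1)
  show ?thesis
    by (subst rpoly_expand) (simp add: poly_eval_def sum prod power mult const)
qed

text \<open>The bounded elements form a subring containing the constants, and the variables generate
  the rest.\<close>

lemma rpoly_archimedeanI:
  fixes Q :: "'n::finite rpoly set"
  assumes "rpoly.qmod Q" "\<And>i. rpoly_var i \<in> rpoly.bounded_elems Q"
  shows "rpoly.archimedean_qmod Q"
proof (rule rpoly.archimedean_qmodI)
  have "p \<in> rpoly.bounded_elems Q" for p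
    by (subst rpoly_expand) (intro rpoly.bounded_elems_sum rpoly.bounded_elems_mult
        rpoly.bounded_elems_const rpoly.bounded_elems_prod rpoly.bounded_elems_power assms)
  then show "rpoly.bounded_elems Q = UNIV" by blast
qed (rule assms)

section \<open>Evaluation and affine forms\<close>

lemma poly_eval_superset:
  assumes "finite S" "Poly_Mapping.keys p \<subseteq> S"
  shows "poly_eval x p = (\<Sum>m\<in>S. Poly_Mapping.lookup p m * (\<Prod>i\<in>UNIV. (x $ i) ^ Poly_Mapping.lookup m i))"
  unfolding poly_eval_def
  by (rule sum.mono_neutral_left) (use assms in \<open>auto simp: in_keys_iff\<close>)

lemma poly_eval_add: "poly_eval x (p + q) = poly_eval x p + poly_eval x q"
proof -
  let ?S = "Poly_Mapping.keys p \<union> Poly_Mapping.keys q"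
  have "Poly_Mapping.keys (p + q) \<subseteq> ?S" by (rule keys_add)
  then show ?thesis
    by (subst (1 2 3) poly_eval_superset[of ?S]) (simp_all add: lookup_add distrib_right sum.distrib)
qed

lemma poly_eval_single:
  "poly_eval x (Poly_Mapping.single m a) = a * (\<Prod>i\<in>UNIV. (x $ i) ^ Poly_Mapping.lookup m i)"
  by (subst poly_eval_superset[of "{m}"]) simp_all

text \<open>The pair \<open>(c, d)\<close> encodes the affine form \<open>c + d\<^sub>1x\<^sub>1 + \<dots> + d\<^sub>nx\<^sub>n\<close>, so evaluation at \<open>x\<close>
  becomes the inner product with \<open>(1, x)\<close>.\<close>

definition aff :: "real \<times> (real ^ 'n) \<Rightarrow> 'n::finite rpoly" where
  "aff e = rpoly_const (fst e) + (\<Sum>i\<in>UNIV. rpoly_const (snd e $ i) * rpoly_var i)"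

definition aff_coeffs :: "'n::finite rpoly \<Rightarrow> real \<times> (real ^ 'n)" where
  "aff_coeffs p = (Poly_Mapping.lookup p 0, \<chi> i. Poly_Mapping.lookup p (Poly_Mapping.single i 1))"

lemma aff_add: "aff (d + e) = aff d + aff e"
  by (simp add: aff_def rpoly.c_add distrib_right sum.distrib)

lemma aff_scaleR: "aff (r *\<^sub>R e) = rpoly_const r * aff e"
  by (simp add: aff_def rpoly.c_mult distrib_left sum_distrib_left mult.assoc)

lemma aff_0: "aff 0 = 0"
  using aff_scaleR[of 0 0] by simp

lemma aff_uminus: "aff (- e) = - aff e"
  using aff_scaleR[of "-1" e] by (simp add: rpoly.c_minus)

lemma aff_sum: "aff (\<Sum>i\<in>I. f i) = (\<Sum>i\<in>I. aff (f i))"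
  by (induction I rule: infinite_finite_induct) (simp_all add: aff_0 aff_add)

lemma aff_const: "aff (r, 0) = rpoly_const r"
  by (simp add: aff_def)

lemma aff_axis: "aff (0, axis i r) = rpoly_const r * rpoly_var i"
  by (simp add: aff_def axis_def if_distrib[of rpoly_const] if_distrib[of "\<lambda>z. z * _"] cong: if_cong)

lemma poly_eval_aff: "poly_eval x (aff e) = (1, x) \<bullet> e"
proof -
  have pow: "(\<Prod>j\<in>UNIV. (x $ j) ^ Poly_Mapping.lookup (Poly_Mapping.single i (1::nat)) j) = x $ i" for i
  proof -
    have "(\<Prod>j\<in>UNIV. (x $ j) ^ Poly_Mapping.lookup (Poly_Mapping.single i (1::nat)) j)
        = (\<Prod>j\<in>UNIV. if j = i then x $ j else 1)"
      by (rule prod.cong) (auto simp: lookup_single when_def)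
    then show ?thesis by simp
  qed
  have sum: "poly_eval x (\<Sum>i\<in>I. f i) = (\<Sum>i\<in>I. poly_eval x (f i))" for f and I :: "'a set"
    by (induction I rule: infinite_finite_induct) (simp_all add: poly_eval_add poly_eval_def[of _ 0])
  show ?thesis
    by (simp add: aff_def rpoly_const_def rpoly_var_def mult_single poly_eval_add sum poly_eval_single
        pow[simplified] inner_prod_def inner_vec_def mult.commute)
qed

text \<open>A monomial whose exponents sum to at most 1 is either 1 or a single variable, so the
  recorded coefficients are all there are.\<close>

lemma aff_coeffs:
  fixes p :: "'n::finite rpoly"
  assumes "total_degree p \<le> 1"
  shows "aff (aff_coeffs p) = p"
proof (rule poly_mapping_eqI)
  fix m :: "'n \<Rightarrow>\<^sub>0 nat"
  have s: "Poly_Mapping.single i (Suc 0) \<noteq> 0" for i :: 'n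
    by (metis lookup_single_eq lookup_zero nat.simps(3))
  have inj: "Poly_Mapping.single i (Suc 0) = Poly_Mapping.single j (Suc 0) \<longleftrightarrow> i = j" for i j :: 'n
    by (metis lookup_single_eq lookup_single_not_eq nat.simps(3))
  have lookup_aff: "Poly_Mapping.lookup (aff (aff_coeffs p)) m =
      (Poly_Mapping.lookup p 0 when 0 = m) +
      (\<Sum>i\<in>UNIV. Poly_Mapping.lookup p (Poly_Mapping.single i 1) when Poly_Mapping.single i 1 = m)"
    by (simp add: aff_def aff_coeffs_def rpoly_const_def rpoly_var_def mult_single lookup_add
        lookup_sum lookup_single)
  consider "m = 0" | j where "m = Poly_Mapping.single j 1"
    | "m \<noteq> 0" "\<And>j. m \<noteq> Poly_Mapping.single j 1" by blast
  then show "Poly_Mapping.lookup (aff (aff_coeffs p)) m = Poly_Mapping.lookup p m"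
  proof cases
    case 1
    then show ?thesis unfolding lookup_aff by (simp add: s)
  next
    case 2
    then show ?thesis unfolding lookup_aff using s[of j] by (simp add: inj when_def)
  next
    case 3
    have "m \<notin> Poly_Mapping.keys p"
    proof
      assume m: "m \<in> Poly_Mapping.keys p"
      let ?D = "(\<lambda>m. \<Sum>i\<in>UNIV. Poly_Mapping.lookup m i) ` Poly_Mapping.keys p"
      have "(\<Sum>i\<in>UNIV. Poly_Mapping.lookup m i) \<le> Max (insert 0 ?D)"
        by (rule Max_ge) (use m in auto)
      then have le: "(\<Sum>i\<in>UNIV. Poly_Mapping.lookup m i) \<le> 1"
        using assms unfolding total_degree_def by linarith
      obtain j where j: "Poly_Mapping.lookup m j \<noteq> 0"
        using 3(1) by (metis lookup_zero poly_mapping_eqI)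
      have split: "(\<Sum>i\<in>UNIV. Poly_Mapping.lookup m i) = Poly_Mapping.lookup m j + (\<Sum>i\<in>UNIV - {j}. Poly_Mapping.lookup m i)"
        by (rule sum.remove) auto
      then have "Poly_Mapping.lookup m j = 1" "(\<Sum>i\<in>UNIV - {j}. Poly_Mapping.lookup m i) = 0"
        using le j by linarith+
      then have "m = Poly_Mapping.single j 1"
        by (intro poly_mapping_eqI) (auto simp: lookup_single when_def)
      then show False using 3(2) by blast
    qed
    moreover have "Poly_Mapping.single i 1 \<noteq> m" for i
      using 3(2)[of i] by (rule not_sym)
    ultimately show ?thesis unfolding lookup_aff using 3(1) by (simp add: in_keys_iff when_def)
  qed
qed

section \<open>Pencils applied to real vectors\<close>

text \<open>For a linear pencil, \<open>pencil_row A v j\<close> and \<open>pencil_form A v\<close>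
  encode the affine forms (Av)_j and v^T A v. Coefficient pairs live in a finite-dimensional
  Euclidean space, where hyperplane separation is available.\<close>

definition pencil_row :: "'n::finite rpoly ^ 'a ^ 'a \<Rightarrow> real ^ 'a \<Rightarrow> 'a::finite \<Rightarrow> real \<times> (real ^ 'n)" where
  "pencil_row A v j = (\<Sum>i\<in>UNIV. v $ i *\<^sub>R aff_coeffs (A $ j $ i))"

definition pencil_form :: "'n::finite rpoly ^ 'a ^ 'a::finite \<Rightarrow> real ^ 'a \<Rightarrow> real \<times> (real ^ 'n)" where
  "pencil_form A v = (\<Sum>j\<in>UNIV. v $ j *\<^sub>R pencil_row A v j)"

definition const_vec :: "real ^ 'a \<Rightarrow> 'n::finite rpoly ^ 'a" where
  "const_vec v = (\<chi> i. rpoly_const (v $ i))"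

context
  fixes A :: "'n::finite rpoly ^ 'a ^ 'a::finite"
  assumes A: "linear_pencil A"
begin

lemma pencil_entry: "aff (aff_coeffs (A $ i $ j)) = A $ i $ j"
  using A by (intro aff_coeffs) (simp add: linear_pencil_def)

lemma pencil_symmetric: "A $ i $ j = A $ j $ i"
proof -
  have "transpose A $ j $ i = A $ j $ i"
    using A by (simp add: linear_pencil_def)
  then show ?thesis by (simp add: transpose_def)
qed

lemma aff_pencil_row: "aff (pencil_row A v j) = (A *v const_vec v) $ j"
  by (simp add: pencil_row_def aff_sum aff_scaleR pencil_entry matrix_vector_mult_def const_vec_def
      mult.commute)

lemma aff_pencil_form: "aff (pencil_form A v) = scalar_product (const_vec v) (A *v const_vec v)"
  by (simp add: pencil_form_def aff_sum aff_scaleR aff_pencil_row scalar_product_def)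
    (simp add: const_vec_def)

lemma inner_pencil_row: "(1, x) \<bullet> pencil_row A v j = (map_matrix (poly_eval x) A *v v) $ j"
proof -
  have "poly_eval x (A $ j $ i) = (1, x) \<bullet> aff_coeffs (A $ j $ i)" for i
    by (metis pencil_entry poly_eval_aff)
  then show ?thesis
    by (simp add: pencil_row_def inner_sum_right matrix_vector_mult_def mult.commute)
qed

lemma inner_pencil_form: "(1, x) \<bullet> pencil_form A v = v \<bullet> (map_matrix (poly_eval x) A *v v)"
  by (simp add: pencil_form_def inner_sum_right inner_pencil_row inner_vec_def)

lemma pencil_value_symmetric:
  "transpose (map_matrix (poly_eval x) A) = map_matrix (poly_eval x) A"
  by (simp add: transpose_def vec_eq_iff pencil_symmetric)

lemma in_spectrahedron_iff: "x \<in> spectrahedron A \<longleftrightarrow> (\<forall>v. 0 \<le> (1, x) \<bullet> pencil_form A v)"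
  by (simp add: spectrahedron_def pos_semidef_def pencil_value_symmetric inner_pencil_form)

end

section \<open>Quadratic modules containing the values of a pencil\<close>

text \<open>Bilinear expansion in which symmetry merges the two cross terms; it serves to perturb
  \<open>v\<close> in the coordinate direction \<open>j\<close>.\<close>

lemma scalar_product_shift:
  fixes A :: "'r::comm_ring_1 ^ 'a ^ 'a::finite"
  assumes sym: "\<And>i j. A $ i $ j = A $ j $ i"
  shows "scalar_product (axis j p + q *s v) (A *v (axis j p + q *s v)) =
    p\<^sup>2 * A $ j $ j + 2 * p * q * (A *v v) $ j + q\<^sup>2 * scalar_product v (A *v v)"
proof -
  have add_l: "scalar_product (u + u') w = scalar_product u w + scalar_product u' w" for u u' w :: "'r ^ 'a"
    by (simp add: scalar_product_def distrib_right sum.distrib)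
  have add_r: "scalar_product u (w + w') = scalar_product u w + scalar_product u w'" for u w w' :: "'r ^ 'a"
    by (simp add: scalar_product_def distrib_left sum.distrib)
  have scale_l: "scalar_product (t *s u) w = t * scalar_product u w" for t and u w :: "'r ^ 'a"
    by (simp add: scalar_product_def sum_distrib_left mult.assoc)
  have scale_r: "scalar_product u (t *s w) = t * scalar_product u w" for t and u w :: "'r ^ 'a"
    by (simp add: scalar_product_def sum_distrib_left mult.left_commute)
  have axis_l: "scalar_product (axis j p) w = p * w $ j" for w :: "'r ^ 'a"
    by (simp add: scalar_product_def axis_def if_distrib[of "\<lambda>z. z * _"] cong: if_cong)
  have A_axis: "(A *v axis j p) $ i = p * A $ j $ i" for i
    by (simp add: matrix_vector_mult_def axis_def if_distrib[of "(*) _"] sym[of i j] mult.commute cong: if_cong)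
  have v_axis: "scalar_product v (A *v axis j p) = p * (A *v v) $ j"
  proof -
    have "scalar_product v (A *v axis j p) = (\<Sum>i\<in>UNIV. v $ i * (p * A $ j $ i))"
      by (simp add: scalar_product_def A_axis)
    then show ?thesis
      by (simp add: matrix_vector_mult_def sum_distrib_left ac_simps)
  qed
  have A_scale: "A *v (q *s v) = q *s (A *v v)"
    by (simp add: vec_eq_iff matrix_vector_mult_def sum_distrib_left mult.left_commute)
  show ?thesis
    by (simp add: matrix_vector_right_distrib add_l add_r scale_l scale_r axis_l A_scale A_axis v_axis)
      (simp add: power2_eq_square algebra_simps)
qed

text \<open>\<open>Q\<close> is kept general because it is instantiated twice: by the quadratic
  module of the pencil itself and by a maximal proper extension of it.\<close>

context
  fixes A :: "'n::finite rpoly ^ 'a ^ 'a::finite" and Q :: "'n rpoly set"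
  assumes A: "linear_pencil A" and Q: "rpoly.qmod Q"
    and AQ: "\<And>v. scalar_product v (A *v v) \<in> Q"
begin

lemma pencil_form_mem: "aff (pencil_form A v) \<in> Q"
  unfolding aff_pencil_form[OF A] by (rule AQ)

lemma aff_mem_add: "aff d \<in> Q \<Longrightarrow> aff e \<in> Q \<Longrightarrow> aff (d + e) \<in> Q"
  by (simp add: aff_add rpoly.qmod_add[OF Q])

lemma aff_mem_scaleR: "aff e \<in> Q \<Longrightarrow> r \<ge> 0 \<Longrightarrow> aff (r *\<^sub>R e) \<in> Q"
  by (simp add: aff_scaleR rpoly.qmod_scale[OF Q])

text \<open>If no \<open>N\<close> worked, a hyperplane would separate the line \<open>N + \<langle>d, x\<rangle>\<close> from the cone of affine forms in \<open>Q\<close>.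
  Being bounded on that line, its normal would be \<open>(0, u)\<close>, and \<open>u\<close> would be a recession direction of the
  spectrahedron.\<close>

lemma affine_bounded_below:
  assumes S: "spectrahedron A \<noteq> {}" "bounded (spectrahedron A)"
  obtains N where "aff (N, d) \<in> Q"
proof -
  let ?C = "{e. aff e \<in> Q}"
  have "\<exists>N. aff (N, d) \<in> Q"
  proof (rule ccontr)
    assume "\<not> ?thesis"
    then have disj: "range (\<lambda>N. (N, d)) \<inter> ?C = {}" by auto
    have 0: "0 \<in> ?C" using rpoly.qmod_0[OF Q] by (simp add: aff_0)
    have 1: "(1, 0) \<in> ?C" using rpoly.qmod_1[OF Q] by (simp add: aff_const)
    have "convex ?C"
      by (rule convexI) (unfold mem_Collect_eq, intro aff_mem_add aff_mem_scaleR)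
    moreover have "convex (range (\<lambda>N::real. (N, d)))"
    proof -
      have "range (\<lambda>N::real. (N, d)) = UNIV \<times> {d}" by auto
      then show ?thesis by (simp add: convex_Times)
    qed
    ultimately obtain a b where ab: "a \<noteq> 0" "\<And>N. a \<bullet> (N, d) \<le> b" "\<And>e. aff e \<in> Q \<Longrightarrow> a \<bullet> e \<ge> b"
      using separating_hyperplane_sets[of "range (\<lambda>N::real. (N, d))" ?C] disj 0 by blast
    have nonneg: "a \<bullet> e \<ge> 0" if "aff e \<in> Q" for e
    proof (rule ccontr)
      assume neg: "\<not> ?thesis"
      \<comment> \<open>Scaling within the cone by this \<open>t\<close> brings the value down to
        \<open>- (\<bar>b\<bar> + 1)\<close>, below the bound \<open>b\<close>.\<close>
      define t where "t = (\<bar>b\<bar> + 1) / - (a \<bullet> e)"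
      have "t \<ge> 0" using neg by (auto simp: t_def intro!: divide_nonneg_neg)
      then have "a \<bullet> (t *\<^sub>R e) \<ge> b" using that ab(3) aff_mem_scaleR by blast
      moreover have "a \<bullet> (t *\<^sub>R e) = - (\<bar>b\<bar> + 1)" using neg by (simp add: t_def)
      ultimately show False by linarith
    qed
    obtain a0 u where a: "a = (a0, u)" by (cases a)
    have "a0 \<ge> 0" using nonneg[of "(1, 0)"] 1 by (simp add: a)
    moreover have "\<not> a0 > 0"
    proof
      assume "a0 > 0"
      \<comment> \<open>This is a point of the line at which the functional exceeds
        \<open>b\<close>.\<close>
      then have "a \<bullet> ((\<bar>b\<bar> + 1 - u \<bullet> d) / a0, d) = \<bar>b\<bar> + 1" by (simp add: a)
      then show False using ab(2)[of "(\<bar>b\<bar> + 1 - u \<bullet> d) / a0"] by linarith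
    qed
    ultimately have u: "a = (0, u)" "u \<noteq> 0" using a ab(1) by (auto simp: zero_prod_def)
    obtain x where x: "x \<in> spectrahedron A" using S(1) by blast
    \<comment> \<open>\<open>(0, u)\<close> is nonnegative on every pencil form, so moving along
      \<open>u\<close> preserves all inequalities defining the spectrahedron.\<close>
    have ray: "x + t *\<^sub>R u \<in> spectrahedron A" if "t \<ge> 0" for t
    proof -
      have "0 \<le> (1, x + t *\<^sub>R u) \<bullet> pencil_form A v" for v
      proof -
        have "(1, x + t *\<^sub>R u) = (1, x) + t *\<^sub>R a" by (simp add: u)
        moreover have "0 \<le> (1, x) \<bullet> pencil_form A v"
          using x in_spectrahedron_iff[OF A] by blast
        ultimately show ?thesis
          using that nonneg[OF pencil_form_mem] by (simp add: inner_add_left)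
      qed
      then show ?thesis using in_spectrahedron_iff[OF A] by blast
    qed
    obtain B where B: "\<And>y. y \<in> spectrahedron A \<Longrightarrow> norm y \<le> B"
      using S(2) bounded_iff by blast
    \<comment> \<open>Long enough for the ray to leave the ball of radius \<open>B\<close>, even
      after the triangle inequality costs \<open>norm x\<close>.\<close>
    define t where "t = (norm x + \<bar>B\<bar> + 1) / norm u"
    have "t \<ge> 0" using u by (simp add: t_def)
    then have "norm (x + t *\<^sub>R u) \<le> B" using ray B by blast
    moreover have "norm (t *\<^sub>R u) = norm x + \<bar>B\<bar> + 1" using u by (simp add: t_def)
    moreover have "norm (t *\<^sub>R u) \<le> norm (x + t *\<^sub>R u) + norm x"
      using norm_triangle_ineq4[of "x + t *\<^sub>R u" x] by simp
    ultimately show False by linarith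
  qed
  then show ?thesis using that by blast
qed

lemma pencil_archimedean:
  assumes S: "spectrahedron A \<noteq> {}" "bounded (spectrahedron A)"
  shows "rpoly.archimedean_qmod Q"
proof (rule rpoly_archimedeanI[OF Q])
  fix i :: 'n
  \<comment> \<open>Adding a nonnegative constant stays in \<open>Q\<close>, so one bound serves
    both signs of the variable.\<close>
  have upper: "aff (max M N, d) \<in> Q" if "aff (M, d) \<in> Q \<or> aff (N, d) \<in> Q" for M N d
  proof -
    have *: "aff (max M N, d) \<in> Q" if "aff (L, d) \<in> Q" "L \<le> max M N" for L
    proof -
      have "aff ((L, d) + (max M N - L) *\<^sub>R (1, 0)) \<in> Q"
        using that rpoly.qmod_1[OF Q] by (intro aff_mem_add aff_mem_scaleR) (auto simp: aff_const)
      then show ?thesis by simp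
    qed
    show ?thesis using that *[of M] *[of N] by auto
  qed
  obtain M N where "aff (M, axis i (-1)) \<in> Q" "aff (N, axis i 1) \<in> Q"
    using affine_bounded_below[OF S] by metis
  then have "aff (max M N, axis i (-1)) \<in> Q" "aff (max M N, axis i 1) \<in> Q"
    using upper by blast+
  moreover have "aff (r, axis i s) = rpoly_const r + rpoly_const s * rpoly_var i" for r s
    using aff_add[of "(r, 0)" "(0, axis i s)"] by (simp add: aff_const aff_axis)
  ultimately show "rpoly_var i \<in> rpoly.bounded_elems Q"
    by (auto simp: rpoly.bounded_elems_def rpoly.c_minus)
qed

section \<open>Radical support and a point of the spectrahedron\<close>

text \<open>Counterpart modulo the support of the fact that a positive semidefinite matrix B with
  v^T B v = 0 satisfies Bv = 0.\<close>

lemma pencil_row_supp: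
  assumes radical: "\<And>p. p\<^sup>2 \<in> rpoly.supp Q \<Longrightarrow> p \<in> rpoly.supp Q"
    and v: "scalar_product v (A *v v) \<in> rpoly.supp Q"
  shows "(A *v v) $ j \<in> rpoly.supp Q"
proof (rule radical)
  let ?l = "(A *v v) $ j"
  \<comment> \<open>The multiplier is chosen such that the form at \<open>l e\<^sub>j + q v\<close> collapses to \<open>-l\<^sup>2\<close>
    modulo the support.\<close>
  let ?q = "- (rpoly_const (1 / 2) * (A $ j $ j + 1))"
  let ?w = "axis j ?l + ?q *s v"
  have half: "2 * rpoly_const (1 / 2) = (1 :: 'n rpoly)"
    by (simp flip: rpoly.c_2 rpoly.c_mult)
  have "?q\<^sup>2 * scalar_product v (A *v v) \<in> rpoly.supp Q"
    using v by (rule rpoly.supp_mult[OF Q])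
  then have "scalar_product ?w (A *v ?w) + - (?q\<^sup>2 * scalar_product v (A *v v)) \<in> Q"
    using AQ by (intro rpoly.qmod_add[OF Q]) (auto simp: rpoly.supp_def)
  also have "scalar_product ?w (A *v ?w) + - (?q\<^sup>2 * scalar_product v (A *v v))
      = ?l\<^sup>2 * A $ j $ j - ?l\<^sup>2 * (2 * rpoly_const (1 / 2)) * (A $ j $ j + 1)"
    unfolding scalar_product_shift[OF pencil_symmetric[OF A]]
    by (simp add: power2_eq_square algebra_simps)
  also have "\<dots> = - ?l\<^sup>2"
    unfolding half by (simp add: algebra_simps)
  finally show "?l\<^sup>2 \<in> rpoly.supp Q"
    using rpoly.qmod_sq[OF Q] by (simp add: rpoly.supp_def)
qed

text \<open>The separating functional, rescaled to take the value 1 on the form 1, is evaluation at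
  a point. There the matrix value of the pencil annihilates \<open>K\<close> and is nonnegative on
  the orthogonal complement of \<open>K\<close>.\<close>

lemma spectrahedron_nonempty:
  assumes proper: "-1 \<notin> Q"
    and radical: "\<And>p. p\<^sup>2 \<in> rpoly.supp Q \<Longrightarrow> p \<in> rpoly.supp Q"
  shows "spectrahedron A \<noteq> {}"
proof -
  define C where "C = {e. aff e \<in> Q}"
  define W where "W = {e. aff e \<in> rpoly.supp Q}"
  define K where "K = {v. \<forall>j. pencil_row A v j \<in> W}"
  \<comment> \<open>Vectors of \<open>K\<close> give forms in \<open>W\<close>, so only the unit
    sphere of the orthogonal complement is kept; it is compact, as strict separation from
    \<open>W\<close> requires.\<close>
  define T where "T = {v. (\<forall>w\<in>K. orthogonal v w) \<and> norm v = 1}"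
  define Y where "Y = convex hull (insert (1, 0) (pencil_form A ` T))"
  have W_add: "d + e \<in> W" if "d \<in> W" "e \<in> W" for d e
    using that by (simp add: W_def aff_add rpoly.supp_add[OF Q])
  have W_scale: "r *\<^sub>R e \<in> W" if "e \<in> W" for r e
    using that by (simp add: W_def aff_scaleR rpoly.supp_mult[OF Q])
  have "0 \<in> W" by (simp add: W_def aff_0 rpoly.supp_0[OF Q])
  then have W: "subspace W" using W_add W_scale by (simp add: subspace_def)
  have row_add: "pencil_row A (v + w) j = pencil_row A v j + pencil_row A w j" for v w j
    by (simp add: pencil_row_def scaleR_add_left sum.distrib)
  have row_scale: "pencil_row A (r *\<^sub>R v) j = r *\<^sub>R pencil_row A v j" for r v j
    by (simp add: pencil_row_def scaleR_sum_right)
  have K: "subspace K"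
    unfolding subspace_def K_def
    using W_add W_scale \<open>0 \<in> W\<close> row_scale[of 0 0] by (simp add: row_add row_scale)
  have W_iff: "e \<in> W \<longleftrightarrow> e \<in> C \<and> - e \<in> C" for e
    by (simp add: W_def C_def rpoly.supp_def aff_uminus)
  have kernel: "v \<in> K" if "pencil_form A v \<in> W" for v
  proof -
    have *: "scalar_product (const_vec v) (A *v const_vec v) \<in> rpoly.supp Q"
      using that by (simp add: W_def aff_pencil_form[OF A])
    have "aff (pencil_row A v j) \<in> rpoly.supp Q" for j
      unfolding aff_pencil_row[OF A] by (rule pencil_row_supp[OF _ *]) (rule radical)
    then show ?thesis by (simp add: K_def W_def)
  qed
  have one: "(1, 0) \<in> C - W"
    using proper rpoly.qmod_1[OF Q] by (simp add: C_def W_def rpoly.supp_def aff_const)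
  have form: "pencil_form A v \<in> C - W" if "v \<in> T" for v
  proof -
    \<comment> \<open>A vector of \<open>K\<close> in \<open>T\<close> would be orthogonal to
      itself, yet of norm 1.\<close>
    have "v \<notin> K" using that by (auto simp: T_def orthogonal_def)
    then show ?thesis using pencil_form_mem kernel by (auto simp: C_def)
  qed
  \<comment> \<open>\<open>W\<close> is the lineality space of the cone \<open>C\<close>, hence a face.\<close>
  have convex: "convex (C - W)"
  proof (rule convexI)
    fix d e and r t :: real
    assume de: "d \<in> C - W" "e \<in> C - W" and rt: "0 \<le> r" "0 \<le> t" "r + t = 1"
    have face_W: "x \<in> W" if "r *\<^sub>R x + t *\<^sub>R y \<in> W" "x \<in> C" "y \<in> C" "r > 0" "t \<ge> 0" for x y and r t :: real
    proof -
      \<comment> \<open>This is the form of \<open>- r *\<^sub>R x\<close>: a cone element added to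
        the negative of an element of \<open>W\<close>.\<close>
      have "aff (- (r *\<^sub>R x + t *\<^sub>R y) + t *\<^sub>R y) \<in> Q"
        using that by (intro aff_mem_add aff_mem_scaleR) (auto simp: W_iff C_def)
      then have "rpoly_const r * aff (- x) \<in> Q" by (simp flip: aff_scaleR)
      then have "aff (- x) \<in> Q" using that rpoly.qmod_scaleD[OF Q] by blast
      then show ?thesis using that by (simp add: W_iff C_def)
    qed
    have "r *\<^sub>R d + t *\<^sub>R e \<in> C"
      using de rt unfolding C_def by (simp add: aff_mem_add aff_mem_scaleR)
    moreover have "r *\<^sub>R d + t *\<^sub>R e \<notin> W"
    proof
      assume *: "r *\<^sub>R d + t *\<^sub>R e \<in> W"
      then have **: "t *\<^sub>R e + r *\<^sub>R d \<in> W" by (simp add: add.commute)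
      show False
      proof (cases "r > 0")
        case True
        then show False using face_W[OF *] de rt by blast
      next
        case False
        then show False using face_W[OF **] de rt by force
      qed
    qed
    ultimately show "r *\<^sub>R d + t *\<^sub>R e \<in> C - W" by blast
  qed
  have YCW: "Y \<subseteq> C - W"
    unfolding Y_def by (rule hull_minimal) (use one form convex in auto)
  have "compact T"
  proof -
    have "T = sphere 0 1 \<inter> (\<Inter>w\<in>K. {v. v \<bullet> w = 0})"
      by (auto simp: T_def orthogonal_def)
    then show ?thesis
      by (auto intro!: compact_Int_closed closed_INT closed_Collect_eq continuous_intros)
  qed
  moreover have "continuous_on T (pencil_form A)"
    unfolding pencil_form_def pencil_row_def by (intro continuous_intros)
  ultimately have "compact Y"
    unfolding Y_def by (intro compact_convex_hull compact_insert compact_continuous_image)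
  moreover have "Y \<noteq> {}" "convex Y" by (auto simp: Y_def)
  ultimately obtain a b where ab: "\<And>e. e \<in> W \<Longrightarrow> a \<bullet> e < b" "\<And>e. e \<in> Y \<Longrightarrow> a \<bullet> e > b"
    using separating_hyperplane_closed_compact[of W Y] W YCW closed_subspace subspace_imp_convex by blast
  \<comment> \<open>A functional bounded above on a subspace vanishes on it: otherwise some multiple
    of \<open>e\<close> attains the value \<open>b\<close>.\<close>
  have aW: "a \<bullet> e = 0" if "e \<in> W" for e
  proof (rule ccontr)
    assume "a \<bullet> e \<noteq> 0"
    then have "a \<bullet> ((b / (a \<bullet> e)) *\<^sub>R e) = b" by simp
    then show False using ab(1)[OF W_scale[OF that, of "b / (a \<bullet> e)"]] by simp
  qed
  have "b > 0" using ab(1)[OF \<open>0 \<in> W\<close>] by simp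
  have "(1, 0) \<in> Y" by (simp add: Y_def hull_inc)
  then have "fst a > 0" using ab(2)[of "(1, 0)"] \<open>b > 0\<close> by (simp add: inner_prod_def)
  \<comment> \<open>Dividing \<open>a\<close> by its positive first component gives
    \<open>(1, x)\<close>, so the functional becomes evaluation of affine forms at
    \<open>x\<close>.\<close>
  define x where "x = snd a /\<^sub>R fst a"
  have x: "(1, x) \<bullet> e = (a \<bullet> e) / fst a" for e
    using \<open>fst a > 0\<close> by (simp add: x_def inner_prod_def field_simps)
  define B where "B = map_matrix (poly_eval x) A"
  have B_sym: "transpose B = B" unfolding B_def by (rule pencil_value_symmetric[OF A])
  have BK: "B *v k = 0" if "k \<in> K" for k
    using that aW by (simp add: vec_eq_iff B_def x K_def flip: inner_pencil_row[OF A])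
  have BT: "z \<bullet> (B *v z) \<ge> 0" if z: "\<And>w. w \<in> K \<Longrightarrow> orthogonal z w" for z
  proof (cases "z = 0")
    case False
    define y where "y = z /\<^sub>R norm z"
    have "y \<in> T" using False z by (auto simp: T_def y_def orthogonal_def)
    then have "pencil_form A y \<in> Y" by (simp add: Y_def hull_inc)
    then have "y \<bullet> (B *v y) \<ge> 0"
      using ab(2)[of "pencil_form A y"] \<open>b > 0\<close> \<open>fst a > 0\<close>
      by (simp add: B_def x flip: inner_pencil_form[OF A])
    moreover have "z = norm z *\<^sub>R y" using False by (simp add: y_def)
    then have "z \<bullet> (B *v z) = (norm z)\<^sup>2 * (y \<bullet> (B *v y))"
      by (metis inner_scaleR_left inner_scaleR_right matrix_vector_mult_scaleR mult.assoc power2_eq_square)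
    ultimately show ?thesis by simp
  qed simp
  \<comment> \<open>Split \<open>v\<close> along \<open>K\<close> and its complement; the part in
    \<open>K\<close> contributes nothing, since \<open>B\<close> annihilates it and is
    symmetric.\<close>
  have "v \<bullet> (B *v v) \<ge> 0" for v
  proof -
    obtain k z where kz: "k \<in> span K" "\<And>w. w \<in> span K \<Longrightarrow> orthogonal z w" "v = k + z"
      using orthogonal_subspace_decomp_exists[of K v] by metis
    have k: "k \<in> K" and z: "\<And>w. w \<in> K \<Longrightarrow> orthogonal z w"
      using kz K span_eq_iff by blast+
    have "B *v v = B *v z" by (simp add: kz(3) matrix_vector_right_distrib BK[OF k])
    moreover have "k \<bullet> (B *v z) = 0"
      using BK[OF k] B_sym by (metis dot_lmul_matrix inner_zero_left vector_transpose_matrix)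
    ultimately have "v \<bullet> (B *v v) = z \<bullet> (B *v z)" by (simp add: kz(3) inner_add_left)
    then show ?thesis using BT[OF z] by simp
  qed
  then have "x \<in> spectrahedron A"
    by (simp add: spectrahedron_def pos_semidef_def B_sym flip: B_def)
  then show ?thesis by blast
qed

end

section \<open>The quadratic module of a pencil\<close>

text \<open>Concatenation of the two families, the second shifted by \<open>k\<close>.\<close>

lemma finite_sums_add:
  fixes g :: "'b \<Rightarrow> 'c::comm_monoid_add" and k l :: nat
  shows "(\<Sum>i<k. g (v i)) + (\<Sum>i<l. g (w i)) = (\<Sum>i<k + l. g (if i < k then v i else w (i - k)))"
  by (induction l) (simp_all add: add.assoc[symmetric])

lemma sums_of_squaresI: "(\<Sum>i<k::nat. (p i)\<^sup>2) \<in> sums_of_squares"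
  unfolding sums_of_squares_def by blast

lemma sums_of_squares_sq: "p\<^sup>2 \<in> sums_of_squares"
  using sums_of_squaresI[of "\<lambda>_. p" 1] by simp

lemma sums_of_squares_add:
  assumes "s \<in> sums_of_squares" "t \<in> sums_of_squares"
  shows "s + t \<in> sums_of_squares"
proof -
  obtain k l :: nat and p q where "s = (\<Sum>i<k. (p i)\<^sup>2)" "t = (\<Sum>i<l. (q i)\<^sup>2)"
    using assms unfolding sums_of_squares_def by blast
  then show ?thesis
    using finite_sums_add[of "\<lambda>p. p\<^sup>2" p k q l] by (simp add: sums_of_squaresI)
qed

lemma quadratic_moduleI:
  "s \<in> sums_of_squares \<Longrightarrow> s + (\<Sum>i<k::nat. scalar_product (v i) (A *v v i)) \<in> quadratic_module A"
  unfolding quadratic_module_def by blast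

lemma quadratic_module_qmod:
  fixes A :: "'n::finite rpoly ^ 'a ^ 'a::finite"
  shows "rpoly.qmod (quadratic_module A)"
proof (rule rpoly.qmodI)
  show "1 \<in> quadratic_module A"
    using quadratic_moduleI[OF sums_of_squares_sq[of 1], where k = 0] by simp
next
  fix a b assume "a \<in> quadratic_module A" "b \<in> quadratic_module A"
  then obtain s t and k l :: nat and v w where
    "a = s + (\<Sum>i<k. scalar_product (v i) (A *v v i))" "s \<in> sums_of_squares"
    "b = t + (\<Sum>i<l. scalar_product (w i) (A *v w i))" "t \<in> sums_of_squares"
    unfolding quadratic_module_def by blast
  moreover from this have "a + b = (s + t) +
      ((\<Sum>i<k. scalar_product (v i) (A *v v i)) + (\<Sum>i<l. scalar_product (w i) (A *v w i)))"
    by (simp add: algebra_simps)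
  ultimately show "a + b \<in> quadratic_module A"
    unfolding finite_sums_add[of "\<lambda>v. scalar_product v (A *v v)"]
    by (simp only: quadratic_moduleI sums_of_squares_add)
next
  fix a b assume "a \<in> quadratic_module A"
  then obtain s and k :: nat and v where
    a: "a = s + (\<Sum>i<k. scalar_product (v i) (A *v v i))" "s \<in> sums_of_squares"
    unfolding quadratic_module_def by blast
  have "scalar_product (b *s u) (A *v (b *s u)) = b\<^sup>2 * scalar_product u (A *v u)" for u
    by (simp add: scalar_product_def matrix_vector_mult_def sum_distrib_left power2_eq_square ac_simps)
  then have "b\<^sup>2 * a = b\<^sup>2 * s + (\<Sum>i<k. scalar_product (b *s v i) (A *v (b *s v i)))"
    by (simp add: a distrib_left sum_distrib_left)
  moreover have "b\<^sup>2 * s \<in> sums_of_squares"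
  proof -
    obtain m :: nat and p where "s = (\<Sum>i<m. (p i)\<^sup>2)"
      using a(2) unfolding sums_of_squares_def by blast
    then have "b\<^sup>2 * s = (\<Sum>i<m. (b * p i)\<^sup>2)"
      by (simp add: sum_distrib_left power_mult_distrib)
    then show ?thesis using sums_of_squaresI by metis
  qed
  ultimately show "b\<^sup>2 * a \<in> quadratic_module A"
    by (simp only: quadratic_moduleI)
qed

lemma quadratic_module_form: "scalar_product v (A *v v) \<in> quadratic_module A"
  using quadratic_moduleI[OF sums_of_squares_sq[of 0], of "\<lambda>_. v" A 1] by simp

theorem corollary4p4p4:
  fixes A :: "'n::finite rpoly ^ 'a ^ 'a::finite" and f :: "'n rpoly"
  assumes "linear_pencil A"
    and "bounded (spectrahedron A)"
    and "\<And>x. x \<in> spectrahedron A \<Longrightarrow> poly_eval x f > 0"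
  shows "f \<in> quadratic_module A"
proof (cases "spectrahedron A = {}")
  case True
  let ?M = "quadratic_module A"
  note M = quadratic_module_qmod[of A]
  have "-1 \<in> ?M"
  proof (rule ccontr)
    assume "-1 \<notin> ?M"
    then obtain Q where Q: "rpoly.maximal_qmod Q" "?M \<subseteq> Q"
      using rpoly.maximal_qmod_exists[OF M] by blast
    have "spectrahedron A \<noteq> {}"
    proof (rule spectrahedron_nonempty[OF assms(1) rpoly.maximal_qmod_qmod[OF Q(1)]])
      show "scalar_product v (A *v v) \<in> Q" for v
        using Q(2) quadratic_module_form by blast
    qed (use Q rpoly.maximal_qmod_proper rpoly.maximal_qmod_supp_radical in blast)+
    then show False using True by blast
  qed
  \<comment> \<open>With 1 in the support, which is an ideal, the module is the whole ring.\<close>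
  then have "1 \<in> rpoly.supp ?M"
    using rpoly.qmod_1[OF M] by (simp add: rpoly.supp_def)
  then show ?thesis
    using rpoly.supp_mult[OF M, of 1 f] by (simp add: rpoly.supp_def)
next
  case False
  show ?thesis
  proof (rule rpoly.putinar)
    show "rpoly.archimedean_qmod (quadratic_module A)"
      by (rule pencil_archimedean[OF assms(1) quadratic_module_qmod quadratic_module_form False assms(2)])
  next
    fix \<phi> :: "'n rpoly \<Rightarrow> real"
    assume \<phi>: "rpoly.real_hom \<phi>" "\<And>p. p \<in> quadratic_module A \<Longrightarrow> \<phi> p \<ge> 0"
    define x where "x = (\<chi> i. \<phi> (rpoly_var i))"
    have eval: "\<phi> p = poly_eval x p" for p
      unfolding x_def by (rule rpoly_real_hom_eq_poly_eval[OF \<phi>(1)])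
    \<comment> \<open>Testing the homomorphism on forms of constant vectors already yields positive
      semidefiniteness at \<open>x\<close>.\<close>
    have "0 \<le> (1, x) \<bullet> pencil_form A v" for v
      using \<phi>(2)[OF quadratic_module_form, of "const_vec v"]
      by (simp add: eval poly_eval_aff flip: aff_pencil_form[OF assms(1)])
    then have "x \<in> spectrahedron A"
      using in_spectrahedron_iff[OF assms(1)] by blast
    then show "\<phi> f > 0" using assms(3) by (simp add: eval)
  qed
qed

end
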